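(* Let $f:\mathbb{R}^{d_x}\to\mathbb{R}$ be convex and $L_f$-smooth for some $L_f>0$, let $g:\mathbb{R}^{d_x}\to\mathbb{R}\cup\{+\infty\}$ be proper, closed and $\mu_g$-strongly convex for some $\mu_g\ge0$, let $h:\mathbb{R}^{d_y}\to\mathbb{R}\cup\{+\infty\}$ be proper, closed and convex with convex conjugate $h^*$ being $\mu_{h^*}$-strongly convex for some $\mu_{h^*}>0$, and let $\mathsf{K}:\mathbb{R}^{d_x}\to\mathbb{R}^{d_y}$ be linear with operator norm $\|\mathsf{K}\|$. Let $(x^\star,y^\star,z^\star)$ satisfy $$0\in\partial g(x^\star)+\mathsf{K}^*y^\star+\nabla f(z^\star),\qquad 0\in\partial h^*(y^\star)-\mathsf{K}x^\star,\qquad z^\star=x^\star.$$ Let $\eta_x,\eta_y,\eta_z>0$ satisfy $\|\mathsf{K}\|^2\eta_x\eta_y+L_f\eta_x\eta_z\le1$, and let $(x^k,y^k,z^k)_{k\ge0}$ be generated, from an arbitrary initial point, by any one of the four algorithms ACV-I, ACV-II, APDTR-I, APDTR-II with these stepsizes. Define $$\Psi_k=\frac1{2\eta_x}\|x^k-x^\star\|^2+\frac1{2\eta_y}\|y^k-y^\star\|^2+\frac1{\eta_z}D_f(z^k;z^\star)+s_1\langle y^k-y^\star,\mathsf{K}(x^k-x^\star)\rangle+s_2\langle\nabla f(z^k)-\nabla f(z^\star),x^k-x^\star\rangle,$$ where $(s_1,s_2)=(-1,-1)$ for ACV-I, $(+1,-1)$ for ACV-II, $(-1,+1)$ for APDTR-I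 and $(+1,+1)$ for APDTR-II. Then for every $k\ge0$, $$\Psi_k\le\theta^k\Psi_0,\qquad\theta=\max\left\{\frac1{1+\mu_g\eta_x},\ \frac1{1+\mu_{h^*}\eta_y},\ \frac2{2+\eta_z}\right\}.$$
   Context: A proper closed function $\phi$ is $\mu$-strongly convex ($\mu\ge0$; $\mu=0$ means convex) if $\phi(x)\ge\phi(y)+\langle p,x-y\rangle+\frac{\mu}{2}\|x-y\|^2$ for all $x,y\in\mathrm{dom}(\phi)$ and all $p\in\partial\phi(y)$. A differentiable $\phi$ is $L$-smooth if $\nabla\phi$ is $L$-Lipschitz. $h^*(y)=\sup_u\{\langle y,u\rangle-h(u)\}$. $D_f(x;y)=f(x)-f(y)-\langle\nabla f(y),x-y\rangle$. $\mathrm{prox}_F(v)=\arg\min_w\{F(w)+\frac12\|w-v\|^2\}$. $\mathsf{K}^*$ is the adjoint of $\mathsf{K}$. The underlying problem is $\min_x f(x)+g(x)+h(\mathsf{K}x)$. Each algorithm starts from $x^0,z^0\in\mathbb{R}^{d_x}$, $y^0\in\mathbb{R}^{d_y}$ and, for $k=0,1,2,\dots$, performs in the order listed: ACV-I: $x^{k+1}=\mathrm{prox}_{\eta_xg}(x^k-\eta_x\mathsf{K}^*y^k-\eta_x\nabla f(z^k))$; $y^{k+1}=\mathrm{prox}_{\eta_yh^*}(y^k+\eta_y\mathsf{K}(2x^{k+1}-x^k))$; $z^{k+1}=\frac1{1+\eta_z}z^k+\frac{\eta_z}{1+\eta_z}(2x^{k+1}-x^k)$. ACV-II: $y^{k+1}=\mathrm{prox}_{\eta_yh^*}(y^k+\eta_y\mathsf{K}x^k)$;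 $x^{k+1}=\mathrm{prox}_{\eta_xg}(x^k-\eta_x\mathsf{K}^*(2y^{k+1}-y^k)-\eta_x\nabla f(z^k))$; $z^{k+1}=\frac1{1+\eta_z}z^k+\frac{\eta_z}{1+\eta_z}(2x^{k+1}-x^k)$. APDTR-I: $z^{k+1}=\frac1{1+\eta_z}z^k+\frac{\eta_z}{1+\eta_z}x^k$; $x^{k+1}=\mathrm{prox}_{\eta_xg}(x^k-\eta_x\mathsf{K}^*y^k-\eta_x(2\nabla f(z^{k+1})-\nabla f(z^k)))$; $y^{k+1}=\mathrm{prox}_{\eta_yh^*}(y^k+\eta_y\mathsf{K}(2x^{k+1}-x^k))$. APDTR-II: $y^{k+1}=\mathrm{prox}_{\eta_yh^*}(y^k+\eta_y\mathsf{K}x^k)$; $z^{k+1}=\frac1{1+\eta_z}z^k+\frac{\eta_z}{1+\eta_z}x^k$; $x^{k+1}=\mathrm{prox}_{\eta_xg}(x^k-\eta_x\mathsf{K}^*(2y^{k+1}-y^k)-\eta_x(2\nabla f(z^{k+1})-\nabla f(z^k)))$. *)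

theory Defs
  imports "HOL-Analysis.Analysis"
begin

definition gradient :: "('a::euclidean_space \<Rightarrow> real) \<Rightarrow> 'a \<Rightarrow> 'a" where
  "gradient f x = (THE D. GDERIV f x :> D)"

definition smooth_fun :: "real \<Rightarrow> ('a::euclidean_space \<Rightarrow> real) \<Rightarrow> bool" where
  "smooth_fun L f \<longleftrightarrow> (\<forall>x. f differentiable (at x)) \<and> L-lipschitz_on UNIV (gradient f)"

definition bregman :: "('a::euclidean_space \<Rightarrow> real) \<Rightarrow> 'a \<Rightarrow> 'a \<Rightarrow> real" where
  "bregman f x y = f x - f y - gradient f y \<bullet> (x - y)"

definition effective_dom :: "('a \<Rightarrow> ereal) \<Rightarrow> 'a set" where
  "effective_dom \<phi> = {x. \<phi> x < \<infinity>}"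

definition ereal_epigraph :: "('a \<Rightarrow> ereal) \<Rightarrow> ('a \<times> real) set" where
  "ereal_epigraph \<phi> = {(x, r). \<phi> x \<le> ereal r}"

definition proper_fun :: "('a \<Rightarrow> ereal) \<Rightarrow> bool" where
  "proper_fun \<phi> \<longleftrightarrow> (\<forall>x. \<phi> x \<noteq> -\<infinity>) \<and> effective_dom \<phi> \<noteq> {}"

definition closed_fun :: "('a::euclidean_space \<Rightarrow> ereal) \<Rightarrow> bool" where
  "closed_fun \<phi> \<longleftrightarrow> closed (ereal_epigraph \<phi>)"

definition convex_fun :: "('a::euclidean_space \<Rightarrow> ereal) \<Rightarrow> bool" where
  "convex_fun \<phi> \<longleftrightarrow> convex (ereal_epigraph \<phi>)"

text \<open>The subdifferential is empty outside the effective domain; for a proper function this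
  already follows from the subgradient inequality.\<close>

definition subdifferential :: "('a::euclidean_space \<Rightarrow> ereal) \<Rightarrow> 'a \<Rightarrow> 'a set" where
  "subdifferential \<phi> y =
     {p. y \<in> effective_dom \<phi> \<and> (\<forall>x. \<phi> x \<ge> \<phi> y + ereal (p \<bullet> (x - y)))}"

text \<open>Convexity is required explicitly: for \<open>\<mu> = 0\<close> the inequality holds for every function
  by definition of the subdifferential, whereas \<open>0\<close>-strong convexity is meant to be
  convexity.\<close>

definition strongly_convex_fun :: "real \<Rightarrow> ('a::euclidean_space \<Rightarrow> ereal) \<Rightarrow> bool" where
  "strongly_convex_fun \<mu> \<phi> \<longleftrightarrow> convex_fun \<phi> \<and>
     (\<forall>x\<in>effective_dom \<phi>. \<forall>y\<in>effective_dom \<phi>. \<forall>p\<in>subdifferential \<phi> y.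
        \<phi> x \<ge> \<phi> y + ereal (p \<bullet> (x - y) + \<mu> / 2 * (norm (x - y))\<^sup>2))"

definition convex_conjugate :: "('a::euclidean_space \<Rightarrow> ereal) \<Rightarrow> 'a \<Rightarrow> ereal" where
  "convex_conjugate h y = (SUP u. ereal (y \<bullet> u) - h u)"

definition prox :: "('a::euclidean_space \<Rightarrow> ereal) \<Rightarrow> 'a \<Rightarrow> 'a" where
  "prox F v = arg_min (\<lambda>w. F w + ereal (1 / 2 * (norm (w - v))\<^sup>2)) (\<lambda>_. True)"

abbreviation scaled_prox :: "real \<Rightarrow> ('a::euclidean_space \<Rightarrow> ereal) \<Rightarrow> 'a \<Rightarrow> 'a" where
  "scaled_prox \<eta> F \<equiv> prox (\<lambda>w. ereal \<eta> * F w)"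

text \<open>Each of the following predicates states that the sequences \<open>x\<close>, \<open>y\<close>, \<open>z\<close> are the iterates
  of the algorithm started at \<open>(x 0, y 0, z 0)\<close>.\<close>

definition ACV_I ::
  "('a::euclidean_space \<Rightarrow> real) \<Rightarrow> ('a \<Rightarrow> ereal) \<Rightarrow> ('b::euclidean_space \<Rightarrow> ereal) \<Rightarrow> ('a \<Rightarrow> 'b) \<Rightarrow>
   real \<Rightarrow> real \<Rightarrow> real \<Rightarrow> (nat \<Rightarrow> 'a) \<Rightarrow> (nat \<Rightarrow> 'b) \<Rightarrow> (nat \<Rightarrow> 'a) \<Rightarrow> bool" where
  "ACV_I f g h K \<eta>x \<eta>y \<eta>z x y z \<longleftrightarrow> (\<forall>k.
     x (Suc k) = scaled_prox \<eta>x g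
       (x k - \<eta>x *\<^sub>R adjoint K (y k) - \<eta>x *\<^sub>R gradient f (z k)) \<and>
     y (Suc k) = scaled_prox \<eta>y (convex_conjugate h)
       (y k + \<eta>y *\<^sub>R K (2 *\<^sub>R x (Suc k) - x k)) \<and>
     z (Suc k) = (1 / (1 + \<eta>z)) *\<^sub>R z k + (\<eta>z / (1 + \<eta>z)) *\<^sub>R (2 *\<^sub>R x (Suc k) - x k))"

definition ACV_II ::
  "('a::euclidean_space \<Rightarrow> real) \<Rightarrow> ('a \<Rightarrow> ereal) \<Rightarrow> ('b::euclidean_space \<Rightarrow> ereal) \<Rightarrow> ('a \<Rightarrow> 'b) \<Rightarrow>
   real \<Rightarrow> real \<Rightarrow> real \<Rightarrow> (nat \<Rightarrow> 'a) \<Rightarrow> (nat \<Rightarrow> 'b) \<Rightarrow> (nat \<Rightarrow> 'a) \<Rightarrow> bool" where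
  "ACV_II f g h K \<eta>x \<eta>y \<eta>z x y z \<longleftrightarrow> (\<forall>k.
     y (Suc k) = scaled_prox \<eta>y (convex_conjugate h) (y k + \<eta>y *\<^sub>R K (x k)) \<and>
     x (Suc k) = scaled_prox \<eta>x g
       (x k - \<eta>x *\<^sub>R adjoint K (2 *\<^sub>R y (Suc k) - y k) - \<eta>x *\<^sub>R gradient f (z k)) \<and>
     z (Suc k) = (1 / (1 + \<eta>z)) *\<^sub>R z k + (\<eta>z / (1 + \<eta>z)) *\<^sub>R (2 *\<^sub>R x (Suc k) - x k))"

definition APDTR_I ::
  "('a::euclidean_space \<Rightarrow> real) \<Rightarrow> ('a \<Rightarrow> ereal) \<Rightarrow> ('b::euclidean_space \<Rightarrow> ereal) \<Rightarrow> ('a \<Rightarrow> 'b) \<Rightarrow>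
   real \<Rightarrow> real \<Rightarrow> real \<Rightarrow> (nat \<Rightarrow> 'a) \<Rightarrow> (nat \<Rightarrow> 'b) \<Rightarrow> (nat \<Rightarrow> 'a) \<Rightarrow> bool" where
  "APDTR_I f g h K \<eta>x \<eta>y \<eta>z x y z \<longleftrightarrow> (\<forall>k.
     z (Suc k) = (1 / (1 + \<eta>z)) *\<^sub>R z k + (\<eta>z / (1 + \<eta>z)) *\<^sub>R x k \<and>
     x (Suc k) = scaled_prox \<eta>x g
       (x k - \<eta>x *\<^sub>R adjoint K (y k)
            - \<eta>x *\<^sub>R (2 *\<^sub>R gradient f (z (Suc k)) - gradient f (z k))) \<and>
     y (Suc k) = scaled_prox \<eta>y (convex_conjugate h)
       (y k + \<eta>y *\<^sub>R K (2 *\<^sub>R x (Suc k) - x k)))"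

definition APDTR_II ::
  "('a::euclidean_space \<Rightarrow> real) \<Rightarrow> ('a \<Rightarrow> ereal) \<Rightarrow> ('b::euclidean_space \<Rightarrow> ereal) \<Rightarrow> ('a \<Rightarrow> 'b) \<Rightarrow>
   real \<Rightarrow> real \<Rightarrow> real \<Rightarrow> (nat \<Rightarrow> 'a) \<Rightarrow> (nat \<Rightarrow> 'b) \<Rightarrow> (nat \<Rightarrow> 'a) \<Rightarrow> bool" where
  "APDTR_II f g h K \<eta>x \<eta>y \<eta>z x y z \<longleftrightarrow> (\<forall>k.
     y (Suc k) = scaled_prox \<eta>y (convex_conjugate h) (y k + \<eta>y *\<^sub>R K (x k)) \<and>
     z (Suc k) = (1 / (1 + \<eta>z)) *\<^sub>R z k + (\<eta>z / (1 + \<eta>z)) *\<^sub>R x k \<and>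
     x (Suc k) = scaled_prox \<eta>x g
       (x k - \<eta>x *\<^sub>R adjoint K (2 *\<^sub>R y (Suc k) - y k)
            - \<eta>x *\<^sub>R (2 *\<^sub>R gradient f (z (Suc k)) - gradient f (z k))))"

end

theory Submission
  imports Defs
begin

text \<open>Each prox update is a subgradient inclusion. Subtracting the optimality conditions at
  the fixed point, pairing with the new errors and using strong monotonicity gives, for every one
  of the four algorithms, an inequality whose bilinear terms telescope into those of \<open>\<Psi>\<close> up to
  the products of successive differences. Under the step size condition these products are
  dominated by the quadratic terms and the cocoercivity bound
  \<open>bregman f u w \<ge> (norm (gradient f u - gradient f w))\<^sup>2 / (2 * L)\<close>. The same bound shows that
  \<open>\<Psi>\<close> is at most twice its diagonal part, symmetrised in the Bregman distance, which the strong
  monotonicity terms control: hence \<open>(1 + c) * \<Psi> (k + 1) \<le> \<Psi> k\<close> with \<open>1 / (1 + c) = \<theta>\<close>.\<close>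

section \<open>Gradients and Bregman distances of smooth convex functions\<close>

lemma gderiv_gradient:
  assumes "f differentiable (at x)"
  shows "GDERIV f x :> gradient f x"
proof -
  obtain f' where f': "(f has_derivative f') (at x)"
    using assms unfolding differentiable_def by blast
  then interpret bounded_linear f' by (rule has_derivative_bounded_linear)
  \<comment> \<open>The value of the adjoint at \<open>1\<close> is the Riesz representative of the
    derivative. Its uniqueness, shown next, is what lets \<open>THE\<close> pick it out.\<close>
  have "f' = (\<lambda>h. h \<bullet> adjoint f' 1)"
    by (rule ext) (simp add: adjoint_works[OF linear_axioms])
  with f' have "GDERIV f x :> adjoint f' 1"
    unfolding gderiv_def by (rule has_derivative_eq_rhs)
  moreover have "D = D'" if "GDERIV f x :> D" "GDERIV f x :> D'" for D D'
  proof -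
    have "(\<lambda>h. h \<bullet> D) = (\<lambda>h. h \<bullet> D')"
      using that unfolding gderiv_def by (rule has_derivative_unique)
    then show ?thesis by (simp only: fun_eq_iff vector_eq_ldot)
  qed
  ultimately show ?thesis
    unfolding gradient_def by (intro theI[of "\<lambda>D. GDERIV f x :> D" "adjoint f' 1"]) blast+
qed

lemma gradient_line_derivative:
  assumes "f differentiable (at (x + t *\<^sub>R d))"
  shows "((\<lambda>t. f (x + t *\<^sub>R d)) has_real_derivative gradient f (x + t *\<^sub>R d) \<bullet> d) (at t)"
proof -
  have "(f has_derivative (\<lambda>h. h \<bullet> gradient f (x + t *\<^sub>R d))) (at (x + t *\<^sub>R d))"
    using gderiv_gradient[OF assms] unfolding gderiv_def .
  moreover have "((\<lambda>t. x + t *\<^sub>R d) has_derivative (\<lambda>h. h *\<^sub>R d)) (at t)"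
    by (auto intro!: derivative_eq_intros)
  ultimately have "((\<lambda>t. f (x + t *\<^sub>R d)) has_derivative
      (\<lambda>h. (h *\<^sub>R d) \<bullet> gradient f (x + t *\<^sub>R d))) (at t)"
    using has_derivative_compose by blast
  then show ?thesis
    unfolding has_field_derivative_def
    by (rule has_derivative_eq_rhs) (simp add: fun_eq_iff inner_commute)
qed

text \<open>Restricting \<open>f\<close> to the line through \<open>w\<close> and \<open>u\<close>
  leaves a convex function of one variable, which at \<open>1\<close> lies above its tangent at
  \<open>0\<close>.\<close>

lemma bregman_nonneg:
  assumes "convex_on UNIV f" and diff: "\<forall>x. f differentiable (at x)"
  shows "bregman f u w \<ge> 0"
proof -
  define \<phi> where "\<phi> t = f (w + t *\<^sub>R (u - w))" for t :: real
  have "convex_on UNIV \<phi>"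
  proof (rule convex_onI)
    fix t a b :: real assume t: "0 < t" "t < 1"
    have "w + ((1 - t) *\<^sub>R a + t *\<^sub>R b) *\<^sub>R (u - w)
        = (1 - t) *\<^sub>R (w + a *\<^sub>R (u - w)) + t *\<^sub>R (w + b *\<^sub>R (u - w))"
      by (simp add: algebra_simps)
    then show "\<phi> ((1 - t) *\<^sub>R a + t *\<^sub>R b) \<le> (1 - t) * \<phi> a + t * \<phi> b"
      unfolding \<phi>_def using convex_onD[OF assms(1), of t] t by auto
  qed auto
  moreover have "(\<phi> has_real_derivative gradient f w \<bullet> (u - w)) (at 0 within UNIV)"
    unfolding \<phi>_def using gradient_line_derivative[of f w 0 "u - w"] diff by simp
  ultimately have "\<phi> 1 - \<phi> 0 \<ge> gradient f w \<bullet> (u - w) * (1 - 0)"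
    by (intro convex_on_imp_above_tangent) auto
  then show ?thesis by (simp add: \<phi>_def bregman_def)
qed

text \<open>Along the segment the gradient moves by at most \<open>L * t * norm d\<close>, so
  \<open>f\<close> minus the linear and quadratic terms of its upper model has nonpositive
  derivative.\<close>

lemma bregman_le_quadratic:
  assumes "smooth_fun L f"
  shows "bregman f u w \<le> L / 2 * (norm (u - w))\<^sup>2"
proof -
  define d where "d = u - w"
  define \<phi> where "\<phi> t = f (w + t *\<^sub>R d) - t * (gradient f w \<bullet> d) - L / 2 * t\<^sup>2 * (norm d)\<^sup>2"
    for t :: real
  have diff: "\<forall>x. f differentiable (at x)" and lip: "L-lipschitz_on UNIV (gradient f)"
    using assms by (auto simp: smooth_fun_def)
  have "\<phi> 1 \<le> \<phi> 0"
  proof (rule DERIV_nonpos_imp_nonincreasing[where f = \<phi>])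
    fix t :: real assume t: "0 \<le> t" "t \<le> 1"
    have der: "(\<phi> has_real_derivative
        (gradient f (w + t *\<^sub>R d) \<bullet> d - gradient f w \<bullet> d - L * t * (norm d)\<^sup>2)) (at t)"
      unfolding \<phi>_def
      by (rule derivative_eq_intros gradient_line_derivative diff[rule_format] refl | simp)+
    have "(gradient f (w + t *\<^sub>R d) - gradient f w) \<bullet> d
        \<le> norm (gradient f (w + t *\<^sub>R d) - gradient f w) * norm d"
      by (rule norm_cauchy_schwarz)
    also have "\<dots> \<le> (L * norm (t *\<^sub>R d)) * norm d"
      using lipschitz_onD[OF lip, of "w + t *\<^sub>R d" w]
      by (intro mult_right_mono) (auto simp: dist_norm)
    also have "\<dots> = L * t * (norm d)\<^sup>2"
      using t by (simp add: power2_eq_square)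
    finally show "\<exists>y. (\<phi> has_real_derivative y) (at t) \<and> y \<le> 0"
      using der by (intro exI[of _ "gradient f (w + t *\<^sub>R d) \<bullet> d - gradient f w \<bullet> d - L * t * (norm d)\<^sup>2"])
        (auto simp: inner_diff_left)
  qed simp
  then show ?thesis by (simp add: \<phi>_def bregman_def d_def)
qed

text \<open>A gradient step from \<open>u\<close> on \<open>bregman f \<cdot> w\<close> decreases it by the right-hand side, and the
  result is nonnegative.\<close>

lemma bregman_ge_gradient_diff:
  assumes "L > 0" and "convex_on UNIV f" and "smooth_fun L f"
  shows "bregman f u w \<ge> (norm (gradient f u - gradient f w))\<^sup>2 / (2 * L)"
proof -
  define G where "G = gradient f u - gradient f w"
  define v where "v = u - (1 / L) *\<^sub>R G"
  have "0 \<le> bregman f v w"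
    using assms by (auto intro!: bregman_nonneg simp: smooth_fun_def)
  \<comment> \<open>Re-basing at \<open>u\<close> exposes \<open>bregman f v u\<close>, to which the
    quadratic bound applies. The step length \<open>1 / L\<close> in \<open>v\<close> minimises the
    resulting upper bound.\<close>
  also have "\<dots> = bregman f u w + bregman f v u + G \<bullet> (v - u)"
    by (simp add: bregman_def G_def inner_simps)
  also have "\<dots> \<le> bregman f u w + L / 2 * (norm (v - u))\<^sup>2 + G \<bullet> (v - u)"
    using bregman_le_quadratic[OF assms(3), of v u] by simp
  also have "\<dots> = bregman f u w - (norm G)\<^sup>2 / (2 * L)"
    using \<open>L > 0\<close>
    by (simp add: v_def power_mult_distrib power_divide dot_square_norm power2_eq_square field_simps)
  finally show ?thesis by (simp add: G_def)
qed

section \<open>Strong monotonicity of subdifferentials and prox steps\<close>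

text \<open>Adding the strong convexity inequalities at \<open>u\<close> and \<open>w\<close>
  cancels the function values, which are finite because both points carry a subgradient and
  \<open>\<phi>\<close> is proper.\<close>

lemma subdifferential_strongly_monotone:
  assumes "proper_fun \<phi>" and "strongly_convex_fun \<mu> \<phi>"
    and p: "p \<in> subdifferential \<phi> u" and q: "q \<in> subdifferential \<phi> w"
  shows "(p - q) \<bullet> (u - w) \<ge> \<mu> * (norm (u - w))\<^sup>2"
proof -
  have dom: "u \<in> effective_dom \<phi>" "w \<in> effective_dom \<phi>"
    using p q by (auto simp: subdifferential_def)
  then obtain a b where ab: "\<phi> u = ereal a" "\<phi> w = ereal b"
    using assms(1) unfolding proper_fun_def effective_dom_def
    by (metis mem_Collect_eq ereal_cases less_irrefl)
  have "\<phi> w \<ge> \<phi> u + ereal (p \<bullet> (w - u) + \<mu> / 2 * (norm (w - u))\<^sup>2)"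
    "\<phi> u \<ge> \<phi> w + ereal (q \<bullet> (u - w) + \<mu> / 2 * (norm (u - w))\<^sup>2)"
    using assms(2) dom p q unfolding strongly_convex_fun_def by blast+
  then show ?thesis
    by (simp add: ab norm_minus_commute inner_simps)
qed

text \<open>Minimising over epigraph pairs makes the objective real-valued and continuous, and
  closedness of \<open>\<phi>\<close> becomes closedness of the feasible set. A compact sublevel set
  then supplies the minimiser.\<close>

lemma closed_fun_prox_exists:
  assumes "proper_fun \<phi>" and cl: "closed_fun \<phi>" and p: "p \<in> subdifferential \<phi> x0" and "\<eta> > 0"
  shows "\<exists>w r. \<phi> w = ereal r \<and>
    (\<forall>u s. \<phi> u \<le> ereal s \<longrightarrow> \<eta> * r + 1 / 2 * (norm (w - v))\<^sup>2 \<le> \<eta> * s + 1 / 2 * (norm (u - v))\<^sup>2)"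
proof -
  have nm: "\<phi> u \<noteq> -\<infinity>" for u using assms(1) by (simp add: proper_fun_def)
  have "\<phi> x0 < \<infinity>" using p by (simp add: subdifferential_def effective_dom_def)
  then obtain a where a: "\<phi> x0 = ereal a" using nm[of x0] by (cases "\<phi> x0") auto
  have minorant: "s \<ge> a + p \<bullet> (u - x0)" if "\<phi> u \<le> ereal s" for u s
  proof -
    have "\<phi> x0 + ereal (p \<bullet> (u - x0)) \<le> \<phi> u" using p by (simp add: subdifferential_def)
    also note that
    finally show ?thesis by (simp add: a)
  qed
  define J where "J ws = \<eta> * snd ws + 1 / 2 * (norm (fst ws - v))\<^sup>2" for ws :: "'a \<times> real"
  define S where "S = ereal_epigraph \<phi> \<inter> {ws. J ws \<le> J (x0, a)}"
  have cont: "continuous_on T J" for T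
    unfolding J_def by (intro continuous_intros)
  have "closed S"
    unfolding S_def using cl cont
    by (intro closed_Int closed_Collect_le) (auto simp: closed_fun_def)
  define M where "M = \<eta> * norm p"
  define C where "C = J (x0, a) - \<eta> * a + M * norm (v - x0)"
  \<comment> \<open>The affine minorant will give \<open>n\<^sup>2 \<le> 2 * C + 2 * M * n\<close>
    for \<open>n = norm (u - v)\<close>, which every \<open>n > B\<close> violates. The
    \<open>+ 1\<close> ensures \<open>n \<ge> 1\<close>.\<close>
  define B where "B = 2 * M + 2 * \<bar>C\<bar> + 1"
  have "M \<ge> 0" using \<open>\<eta> > 0\<close> by (simp add: M_def)
  have bound: "norm (u - v) \<le> B \<and> a - norm p * (B + norm (v - x0)) \<le> s \<and> s \<le> J (x0, a) / \<eta>"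
    if us: "(u, s) \<in> S" for u s
  proof -
    have le: "\<phi> u \<le> ereal s" "\<eta> * s + 1 / 2 * (norm (u - v))\<^sup>2 \<le> J (x0, a)"
      using us by (auto simp: S_def ereal_epigraph_def J_def)
    have "- (p \<bullet> (u - x0)) \<le> norm p * norm (u - x0)"
      using norm_cauchy_schwarz[of "- p" "u - x0"] by simp
    also have "norm (u - x0) \<le> norm (u - v) + norm (v - x0)"
      using norm_triangle_ineq[of "u - v" "v - x0"] by simp
    finally have s: "a - norm p * (norm (u - v) + norm (v - x0)) \<le> s"
      using minorant[OF le(1)] by (simp add: mult_left_mono)
    then have "\<eta> * (a - norm p * (norm (u - v) + norm (v - x0))) \<le> \<eta> * s"
      using \<open>\<eta> > 0\<close> by simp
    then have sq: "(norm (u - v))\<^sup>2 \<le> 2 * C + 2 * M * norm (u - v)"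
      using le(2) by (simp add: C_def M_def algebra_simps)
    have nB: "norm (u - v) \<le> B"
    proof (rule ccontr)
      assume "\<not> norm (u - v) \<le> B"
      then have gt: "norm (u - v) > 2 * M + 2 * \<bar>C\<bar> + 1" by (simp add: B_def)
      then have "norm (u - v) * norm (u - v) \<ge> (2 * M + 2 * \<bar>C\<bar> + 1) * norm (u - v)"
        by (intro mult_right_mono) auto
      moreover have "2 * \<bar>C\<bar> * norm (u - v) \<ge> 2 * \<bar>C\<bar> * 1"
        using gt \<open>M \<ge> 0\<close> by (intro mult_left_mono) auto
      ultimately show False
        using sq gt \<open>M \<ge> 0\<close> abs_ge_self[of C] by (simp add: power2_eq_square algebra_simps)
    qed
    have "norm p * norm (u - v) \<le> norm p * B"
      using nB by (intro mult_left_mono) auto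
    moreover have "\<eta> * s \<le> J (x0, a)"
      using le(2) zero_le_power2[of "norm (u - v)"] by linarith
    ultimately show ?thesis
      using nB s \<open>\<eta> > 0\<close> by (auto simp: field_simps)
  qed
  have "S \<subseteq> cball v B \<times> {a - norm p * (B + norm (v - x0)) .. J (x0, a) / \<eta>}"
    using bound by (auto simp: dist_norm norm_minus_commute)
  then have "bounded S"
    by (rule bounded_subset[rotated]) (intro bounded_Times bounded_cball bounded_closed_interval)
  with \<open>closed S\<close> have "compact S" by (simp add: compact_eq_bounded_closed)
  moreover have x0S: "(x0, a) \<in> S" by (simp add: S_def ereal_epigraph_def a)
  ultimately obtain ws where ws: "ws \<in> S" "\<forall>us\<in>S. J ws \<le> J us"
    using continuous_attains_inf[of S J] cont by blast
  obtain w r0 where [simp]: "ws = (w, r0)" by (cases ws)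
  have min: "J (w, r0) \<le> J (u, s)" if "\<phi> u \<le> ereal s" for u s
  proof (cases "J (u, s) \<le> J (x0, a)")
    case True
    then have "(u, s) \<in> S" using that by (simp add: S_def ereal_epigraph_def)
    then show ?thesis using ws(2) by auto
  next
    case False
    then show ?thesis using ws(2) x0S by force
  qed
  \<comment> \<open>Lowering the height \<open>r0\<close> of the minimal pair to the value of
    \<open>\<phi>\<close> at \<open>w\<close> cannot increase the objective.\<close>
  have "\<phi> w \<le> ereal r0" using ws(1) by (simp add: S_def ereal_epigraph_def)
  then obtain r where r: "\<phi> w = ereal r" "r \<le> r0" using nm[of w] by (cases "\<phi> w") auto
  have "\<eta> * r \<le> \<eta> * r0" using r(2) \<open>\<eta> > 0\<close> by simp
  then have "J (w, r) \<le> J (u, s)" if "\<phi> u \<le> ereal s" for u s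
    using min[OF that] by (simp add: J_def)
  then show ?thesis using r(1) by (auto simp: J_def)
qed

text \<open>A subgradient at some point supplies the affine minorant that makes the prox objective
  coercive, so that the \<open>arg_min\<close> in \<open>prox\<close> is attained.\<close>

lemma scaled_prox_subgradient:
  assumes pr: "proper_fun \<phi>" and "closed_fun \<phi>" and cv: "convex_fun \<phi>"
    and "p \<in> subdifferential \<phi> x0" and "\<eta> > 0"
  shows "(1 / \<eta>) *\<^sub>R (v - scaled_prox \<eta> \<phi> v) \<in> subdifferential \<phi> (scaled_prox \<eta> \<phi> v)"
proof -
  let ?J = "\<lambda>w. ereal \<eta> * \<phi> w + ereal (1 / 2 * (norm (w - v))\<^sup>2)"
  define w where "w = scaled_prox \<eta> \<phi> v"
  have nm: "\<phi> u \<noteq> -\<infinity>" for u using pr by (simp add: proper_fun_def)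
  obtain w0 r0 where w0: "\<phi> w0 = ereal r0"
    "\<And>u s. \<phi> u \<le> ereal s \<Longrightarrow> \<eta> * r0 + 1 / 2 * (norm (w0 - v))\<^sup>2 \<le> \<eta> * s + 1 / 2 * (norm (u - v))\<^sup>2"
    using closed_fun_prox_exists[OF pr assms(2) assms(4,5), of v] by blast
  have "?J w0 \<le> ?J u" for u
    using w0(1) w0(2)[of u] nm[of u] \<open>\<eta> > 0\<close> by (cases "\<phi> u") auto
  then have "is_arg_min ?J (\<lambda>_. True) w0"
    by (simp add: is_arg_min_def not_less)
  then have "is_arg_min ?J (\<lambda>_. True) w"
    unfolding w_def prox_def arg_min_def by (rule someI)
  then have min: "?J w \<le> ?J u" for u
    by (simp add: is_arg_min_def not_less)
  obtain r where r: "\<phi> w = ereal r"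
    using min[of w0] w0(1) nm[of w] \<open>\<eta> > 0\<close> by (cases "\<phi> w") auto
  have minr: "\<eta> * r + 1 / 2 * (norm (w - v))\<^sup>2 \<le> \<eta> * s + 1 / 2 * (norm (u - v))\<^sup>2"
    if us: "\<phi> u \<le> ereal s" for u s
  proof -
    obtain s' where s': "\<phi> u = ereal s'" "s' \<le> s" using us nm[of u] by (cases "\<phi> u") auto
    moreover from this have "\<eta> * s' \<le> \<eta> * s" using \<open>\<eta> > 0\<close> by simp
    ultimately show ?thesis using min[of u] r by simp
  qed
  have "\<phi> u \<ge> \<phi> w + ereal (((1 / \<eta>) *\<^sub>R (v - w)) \<bullet> (u - w))" for u
  proof (cases "\<phi> u")
    case (real s)
    \<comment> \<open>Moving from \<open>w\<close> a fraction \<open>t\<close> towards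
      \<open>u\<close> changes the objective by at most
      \<open>t * (A + t * (1 / 2 * (norm (u - w))\<^sup>2))\<close>. Minimality, division by
      \<open>t\<close> and \<open>t\<close> tending to \<open>0\<close> give
      \<open>0 \<le> A\<close>, which is the subgradient inequality times
      \<open>\<eta>\<close>.\<close>
    define A where "A = \<eta> * (s - r) + (w - v) \<bullet> (u - w)"
    have ineq: "0 \<le> A + t * (1 / 2 * (norm (u - w))\<^sup>2)" if t: "0 < t" "t \<le> 1" for t
    proof -
      have "(1 - t) *\<^sub>R (w, r) + t *\<^sub>R (u, s) \<in> ereal_epigraph \<phi>"
        using cv t r real unfolding convex_fun_def
        by (intro convexD) (auto simp: ereal_epigraph_def)
      then have "\<phi> ((1 - t) *\<^sub>R w + t *\<^sub>R u) \<le> ereal ((1 - t) * r + t * s)"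
        by (simp add: ereal_epigraph_def)
      note minr[OF this]
      also have "(1 - t) *\<^sub>R w + t *\<^sub>R u - v = (w - v) + t *\<^sub>R (u - w)"
        by (simp add: algebra_simps)
      also have "(norm \<dots>)\<^sup>2
          = (norm (w - v))\<^sup>2 + 2 * t * ((w - v) \<bullet> (u - w)) + t\<^sup>2 * (norm (u - w))\<^sup>2"
        unfolding power2_norm_eq_inner
        by (simp add: inner_add_left inner_add_right inner_commute[of "u - w" "w - v"]
            power2_eq_square distrib_left)
      finally have "0 \<le> t * (A + t * (1 / 2 * (norm (u - w))\<^sup>2))"
        by (simp add: A_def power2_eq_square algebra_simps)
      then show ?thesis using t by (simp add: zero_le_mult_iff)
    qed
    have "((\<lambda>t. A + t * (1 / 2 * (norm (u - w))\<^sup>2)) \<longlongrightarrow> A + 0 * (1 / 2 * (norm (u - w))\<^sup>2)) (at_right 0)"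
      by (intro tendsto_intros)
    moreover have "\<forall>\<^sub>F t in at_right (0::real). 0 \<le> A + t * (1 / 2 * (norm (u - w))\<^sup>2)"
      using ineq by (intro eventually_at_rightI[of 0 1]) auto
    ultimately have "0 \<le> A"
      by (intro tendsto_lowerbound[of _ A "at_right 0"]) auto
    then show ?thesis
      using \<open>\<eta> > 0\<close> by (simp add: real r A_def inner_diff_left field_simps)
  qed (use nm in auto)
  then show ?thesis
    using r by (simp add: subdifferential_def effective_dom_def flip: w_def)
qed

section \<open>Closedness and properness of the conjugate\<close>

text \<open>The epigraph is an intersection of closed half-spaces, one for each \<open>u\<close>
  with finite \<open>h u\<close>; every other \<open>u\<close> contributes the whole space.\<close>

lemma closed_convex_conjugate:
  assumes "proper_fun h"
  shows "closed_fun (convex_conjugate h)"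
proof -
  have "ereal_epigraph (convex_conjugate h) = (\<Inter>u. {yr. ereal (fst yr \<bullet> u) - h u \<le> ereal (snd yr)})"
    by (auto simp: ereal_epigraph_def convex_conjugate_def SUP_le_iff)
  moreover have "closed {yr. ereal (fst yr \<bullet> u) - h u \<le> ereal (snd yr)}" for u
  proof (cases "h u")
    case (real s)
    have "closed {yr. fst yr \<bullet> u - s \<le> snd yr}"
      by (intro closed_Collect_le continuous_intros)
    then show ?thesis by (simp add: real)
  qed (use assms in \<open>auto simp: proper_fun_def\<close>)
  ultimately show ?thesis by (auto simp: closed_fun_def)
qed

text \<open>One finite value of \<open>h\<close> gives a real affine minorant, which rules out
  \<open>-\<infinity>\<close>. In the application, the subgradient at \<open>ys\<close> makes the
  domain nonempty.\<close>

lemma proper_convex_conjugate: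
  assumes "proper_fun h" and "effective_dom (convex_conjugate h) \<noteq> {}"
  shows "proper_fun (convex_conjugate h)"
proof -
  obtain u s where "h u = ereal s"
    using assms(1) unfolding proper_fun_def effective_dom_def
    by (metis (mono_tags) Collect_empty_eq ereal_cases less_irrefl)
  then have "ereal (y \<bullet> u - s) \<le> convex_conjugate h y" for y
    unfolding convex_conjugate_def by (intro SUP_upper2[of u]) auto
  then show ?thesis
    using assms(2) by (auto simp: proper_fun_def) (metis ereal_infty_less_eq(2) PInfty_neq_ereal MInfty_neq_ereal(1))
qed

section \<open>Cross terms and the one-step Lyapunov decrease\<close>

lemma young_inequality:
  fixes a b c :: real
  assumes "c > 0"
  shows "a * b \<le> a\<^sup>2 / (2 * c) + c * b\<^sup>2 / 2"
proof -
  have "0 \<le> (a - c * b)\<^sup>2 / (2 * c)" using assms by simp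
  also have "\<dots> = a\<^sup>2 / (2 * c) + c * b\<^sup>2 / 2 - a * b"
    using assms by (simp add: power2_eq_square field_simps)
  finally show ?thesis by simp
qed

text \<open>Young's inequality with weights \<open>\<eta>y\<close> and \<open>L * \<eta>z\<close>
  leaves two multiples of \<open>(norm u)\<^sup>2\<close>, whose sum the step size condition bounds
  by \<open>1 / (2 * \<eta>x)\<close>. It serves twice: for successive differences and for the
  errors themselves.\<close>

lemma cross_terms_bound:
  fixes K :: "'a::euclidean_space \<Rightarrow> 'b::euclidean_space"
  assumes "linear K" and pos: "L > 0" "\<eta>x > 0" "\<eta>y > 0" "\<eta>z > 0"
    and step: "(onorm K)\<^sup>2 * \<eta>x * \<eta>y + L * \<eta>x * \<eta>z \<le> 1"
  shows "\<bar>v \<bullet> K u\<bar> + \<bar>G \<bullet> u\<bar>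
    \<le> (norm u)\<^sup>2 / (2 * \<eta>x) + (norm v)\<^sup>2 / (2 * \<eta>y) + (norm G)\<^sup>2 / (2 * L) / \<eta>z"
proof -
  have "\<bar>v \<bullet> K u\<bar> \<le> norm v * norm (K u)" by (rule Cauchy_Schwarz_ineq2)
  also have "\<dots> \<le> norm v * (onorm K * norm u)"
    using \<open>linear K\<close> by (intro mult_left_mono onorm) (auto simp: linear_conv_bounded_linear)
  also have "\<dots> \<le> (norm v)\<^sup>2 / (2 * \<eta>y) + \<eta>y * (onorm K * norm u)\<^sup>2 / 2"
    using pos by (intro young_inequality)
  finally have 1: "\<bar>v \<bullet> K u\<bar> \<le> (norm v)\<^sup>2 / (2 * \<eta>y) + \<eta>y * (onorm K)\<^sup>2 / 2 * (norm u)\<^sup>2"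
    by (simp add: power_mult_distrib)
  have "\<bar>G \<bullet> u\<bar> \<le> norm G * norm u" by (rule Cauchy_Schwarz_ineq2)
  also have "\<dots> \<le> (norm G)\<^sup>2 / (2 * (L * \<eta>z)) + (L * \<eta>z) * (norm u)\<^sup>2 / 2"
    using pos by (intro young_inequality) simp
  finally have 2: "\<bar>G \<bullet> u\<bar> \<le> (norm G)\<^sup>2 / (2 * L) / \<eta>z + L * \<eta>z / 2 * (norm u)\<^sup>2"
    by simp
  have "\<eta>y * (onorm K)\<^sup>2 / 2 + L * \<eta>z / 2 \<le> 1 / (2 * \<eta>x)"
    using step pos by (simp add: field_simps)
  then have "(\<eta>y * (onorm K)\<^sup>2 / 2 + L * \<eta>z / 2) * (norm u)\<^sup>2 \<le> 1 / (2 * \<eta>x) * (norm u)\<^sup>2"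
    by (rule mult_right_mono) simp
  with 1 2 show ?thesis by (simp add: distrib_right)
qed

lemma inner_diff_polarization:
  "(a - b) \<bullet> b = ((norm a)\<^sup>2 - (norm b)\<^sup>2 - (norm (b - a))\<^sup>2) / 2"
  unfolding power2_norm_eq_inner by (simp add: inner_simps inner_commute[of b a])

text \<open>\<open>\<Psi>\<close> as a function of a single iterate; keeping the signs as parameters
  lets one estimate cover all four algorithms.\<close>

definition lyapunov ::
  "('a::euclidean_space \<Rightarrow> real) \<Rightarrow> ('a \<Rightarrow> 'b::euclidean_space) \<Rightarrow> real \<Rightarrow> real \<Rightarrow> real \<Rightarrow> real \<Rightarrow> real \<Rightarrow>
   'a \<Rightarrow> 'a \<Rightarrow> 'b \<Rightarrow> 'a \<Rightarrow> real" where
  "lyapunov f K \<eta>x \<eta>y \<eta>z s1 s2 zs u v z =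
     (norm u)\<^sup>2 / (2 * \<eta>x) + (norm v)\<^sup>2 / (2 * \<eta>y) + bregman f z zs / \<eta>z
     + s1 * (v \<bullet> K u) + s2 * ((gradient f z - gradient f zs) \<bullet> u)"

text \<open>Here \<open>u\<close>, \<open>v\<close> stand for the errors \<open>x - xs\<close>, \<open>y - ys\<close>, and primes for the next iterate. The
  assumption \<open>opt\<close> is the sum of the optimality conditions of the three updates, which up to
  the signs \<open>s1\<close>, \<open>s2\<close> has this same form for all four algorithms.\<close>

lemma lyapunov_decrease:
  fixes K :: "'a::euclidean_space \<Rightarrow> 'b::euclidean_space"
  assumes "convex_on UNIV f" and "smooth_fun L f" and "linear K"
    and pos: "L > 0" "\<eta>x > 0" "\<eta>y > 0" "\<eta>z > 0"
    and step: "(onorm K)\<^sup>2 * \<eta>x * \<eta>y + L * \<eta>x * \<eta>z \<le> 1"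
    and s: "\<bar>s1\<bar> = 1" "\<bar>s2\<bar> = 1"
    and G: "G = gradient f z - gradient f zs" and G': "G' = gradient f z' - gradient f zs"
    and opt: "\<mu>g * (norm u')\<^sup>2 + \<mu>h * (norm v')\<^sup>2 + G' \<bullet> (z' - zs) \<le>
       (u - u') \<bullet> u' / \<eta>x + (v - v') \<bullet> v' / \<eta>y + G' \<bullet> (z - z') / \<eta>z
       + s1 * (v \<bullet> K u - v' \<bullet> K u' - (v' - v) \<bullet> K (u' - u))
       + s2 * (G \<bullet> u - G' \<bullet> u' - (G' - G) \<bullet> (u' - u))"
    and c: "0 \<le> c" "c \<le> \<mu>g * \<eta>x" "c \<le> \<mu>h * \<eta>y" "c \<le> \<eta>z / 2"
  shows "(1 + c) * lyapunov f K \<eta>x \<eta>y \<eta>z s1 s2 zs u' v' z' \<le> lyapunov f K \<eta>x \<eta>y \<eta>z s1 s2 zs u v z"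
proof -
  let ?\<Psi> = "lyapunov f K \<eta>x \<eta>y \<eta>z s1 s2 zs u v z" and ?\<Psi>' = "lyapunov f K \<eta>x \<eta>y \<eta>z s1 s2 zs u' v' z'"
  note cross = cross_terms_bound[OF \<open>linear K\<close> pos step]
  have signed: "s1 * t1 + s2 * t2 \<le> \<bar>t1\<bar> + \<bar>t2\<bar>" "- (\<bar>t1\<bar> + \<bar>t2\<bar>) \<le> s1 * t1 + s2 * t2"
    for t1 t2 :: real
    using s by (auto simp: abs_if split: if_splits)
  have coco: "(norm (gradient f a - gradient f b))\<^sup>2 / (2 * L) / \<eta>z \<le> bregman f a b / \<eta>z" for a b
    using bregman_ge_gradient_diff[OF pos(1) assms(1,2)] pos by (intro divide_right_mono) auto
  \<comment> \<open>The three-point identity makes the Bregman term telescope and leaves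
    \<open>bregman f z z'\<close> to absorb the gradient differences.\<close>
  have 3: "G' \<bullet> (z - z') / \<eta>z = bregman f z zs / \<eta>z - bregman f z' zs / \<eta>z - bregman f z z' / \<eta>z"
    unfolding G' bregman_def by (simp add: inner_simps flip: diff_divide_distrib)
  \<comment> \<open>\<open>R\<close> gathers all that does not telescope. Its two signed products
    are dominated by its three other terms, the third through cocoercivity.\<close>
  define R where "R = (norm (u' - u))\<^sup>2 / (2 * \<eta>x) + (norm (v' - v))\<^sup>2 / (2 * \<eta>y) + bregman f z z' / \<eta>z
     + (s1 * ((v' - v) \<bullet> K (u' - u)) + s2 * ((G' - G) \<bullet> (u' - u)))"
  have "norm (G' - G) = norm (gradient f z - gradient f z')"
    by (simp add: G G' norm_minus_commute)
  then have "R \<ge> 0"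
    using cross[of "v' - v" "u' - u" "G' - G"] coco[of z z']
      signed(2)[of "(v' - v) \<bullet> K (u' - u)" "(G' - G) \<bullet> (u' - u)"]
    by (simp add: R_def)
  moreover have "\<mu>g * (norm u')\<^sup>2 + \<mu>h * (norm v')\<^sup>2 + G' \<bullet> (z' - zs) \<le> ?\<Psi> - ?\<Psi>' - R"
    using opt unfolding 3 inner_diff_polarization lyapunov_def R_def G[symmetric] G'[symmetric]
    by (simp add: diff_divide_distrib add_divide_distrib algebra_simps)
  ultimately have dec: "\<mu>g * (norm u')\<^sup>2 + \<mu>h * (norm v')\<^sup>2 + G' \<bullet> (z' - zs) \<le> ?\<Psi> - ?\<Psi>'"
    by simp
  \<comment> \<open>Of the two Bregman distances, the first occurs in the Lyapunov function and the
    reversed one pays for its gradient cross term.\<close>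
  have symm: "G' \<bullet> (z' - zs) / \<eta>z = bregman f z' zs / \<eta>z + bregman f zs z' / \<eta>z"
    unfolding G' bregman_def by (simp add: inner_simps flip: add_divide_distrib)
  have "norm G' = norm (gradient f zs - gradient f z')"
    by (simp add: G' norm_minus_commute)
  then have "?\<Psi>' \<le> (norm u')\<^sup>2 / \<eta>x + (norm v')\<^sup>2 / \<eta>y + G' \<bullet> (z' - zs) / \<eta>z"
    using cross[of v' u' G'] coco[of zs z'] signed(1)[of "v' \<bullet> K u'" "G' \<bullet> u'"]
    unfolding symm lyapunov_def G'[symmetric] by simp
  then have "c * ?\<Psi>' \<le> c * ((norm u')\<^sup>2 / \<eta>x + (norm v')\<^sup>2 / \<eta>y + G' \<bullet> (z' - zs) / \<eta>z)"
    using c(1) by (rule mult_left_mono)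
  also have "\<dots> = c / \<eta>x * (norm u')\<^sup>2 + c / \<eta>y * (norm v')\<^sup>2 + c / \<eta>z * (G' \<bullet> (z' - zs))"
    by (simp add: distrib_left)
  also have "\<dots> \<le> \<mu>g * (norm u')\<^sup>2 + \<mu>h * (norm v')\<^sup>2 + 1 * (G' \<bullet> (z' - zs))"
  proof (intro add_mono mult_right_mono)
    have "bregman f a b \<ge> 0" for a b
      using assms(1,2) by (auto intro!: bregman_nonneg simp: smooth_fun_def)
    then have "0 \<le> G' \<bullet> (z' - zs) / \<eta>z" unfolding symm using pos by simp
    then show "0 \<le> G' \<bullet> (z' - zs)" using pos by (simp add: zero_le_divide_iff)
  qed (use c pos in \<open>auto simp: field_simps\<close>)
  finally show ?thesis using dec by (simp add: distrib_right)
qed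

section \<open>Optimality inequalities of the updates and linear convergence\<close>

theorem theorem2:
  fixes f :: "'a::euclidean_space \<Rightarrow> real"
    and g :: "'a \<Rightarrow> ereal"
    and h :: "'b::euclidean_space \<Rightarrow> ereal"
    and K :: "'a \<Rightarrow> 'b"
    and L\<^sub>f \<mu>g \<mu>h \<eta>x \<eta>y \<eta>z s1 s2 \<theta> :: real
    and x z :: "nat \<Rightarrow> 'a" and y :: "nat \<Rightarrow> 'b"
    and xs zs :: 'a and ys :: 'b
    and \<Psi> :: "nat \<Rightarrow> real"
  assumes "L\<^sub>f > 0" and "convex_on UNIV f" and "smooth_fun L\<^sub>f f"
    and "\<mu>g \<ge> 0" and "proper_fun g" and "closed_fun g" and "strongly_convex_fun \<mu>g g"
    and "proper_fun h" and "closed_fun h" and "convex_fun h"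
    and "\<mu>h > 0" and "strongly_convex_fun \<mu>h (convex_conjugate h)"
    and "linear K"
    and "0 \<in> (\<lambda>p. p + adjoint K ys + gradient f zs) ` subdifferential g xs"
    and "0 \<in> (\<lambda>q. q - K xs) ` subdifferential (convex_conjugate h) ys"
    and "zs = xs"
    and "\<eta>x > 0" and "\<eta>y > 0" and "\<eta>z > 0"
    and "(onorm K)\<^sup>2 * \<eta>x * \<eta>y + L\<^sub>f * \<eta>x * \<eta>z \<le> 1"
    and "(ACV_I f g h K \<eta>x \<eta>y \<eta>z x y z \<and> s1 = -1 \<and> s2 = -1) \<or>
         (ACV_II f g h K \<eta>x \<eta>y \<eta>z x y z \<and> s1 = 1 \<and> s2 = -1) \<or>
         (APDTR_I f g h K \<eta>x \<eta>y \<eta>z x y z \<and> s1 = -1 \<and> s2 = 1) \<or>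
         (APDTR_II f g h K \<eta>x \<eta>y \<eta>z x y z \<and> s1 = 1 \<and> s2 = 1)"
    and "\<And>k. \<Psi> k = 1 / (2 * \<eta>x) * (norm (x k - xs))\<^sup>2 + 1 / (2 * \<eta>y) * (norm (y k - ys))\<^sup>2
           + 1 / \<eta>z * bregman f (z k) zs
           + s1 * ((y k - ys) \<bullet> K (x k - xs))
           + s2 * ((gradient f (z k) - gradient f zs) \<bullet> (x k - xs))"
    and "\<theta> = Max {1 / (1 + \<mu>g * \<eta>x), 1 / (1 + \<mu>h * \<eta>y), 2 / (2 + \<eta>z)}"
  shows "\<forall>k. \<Psi> k \<le> \<theta> ^ k * \<Psi> 0"

proof -
  note linK = \<open>linear K\<close>
  let ?h = "convex_conjugate h"
  define p where "p = - adjoint K ys - gradient f zs"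
  have p: "p \<in> subdifferential g xs"
  proof -
    obtain p' where p': "p' \<in> subdifferential g xs" "0 = p' + adjoint K ys + gradient f zs"
      using assms(14) by blast
    have "p' = (p' + adjoint K ys + gradient f zs) + p" by (simp add: p_def)
    then show ?thesis using p' by simp
  qed
  have q: "K xs \<in> subdifferential ?h ys"
    using assms(15) by auto
  then have "proper_fun ?h"
    using \<open>proper_fun h\<close> by (intro proper_convex_conjugate) (auto simp: subdifferential_def)
  have "closed_fun ?h" by (rule closed_convex_conjugate) fact
  have cv: "convex_fun g" "convex_fun ?h"
    using assms by (auto simp: strongly_convex_fun_def)
  \<comment> \<open>\<open>w\<close> stands for \<open>y k\<close> or its extrapolation, and
    \<open>b\<close> for the current gradient or the extrapolated one, so one inequality fits all
    four primal updates.\<close>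
  have xopt: "\<mu>g * (norm (x' - xs))\<^sup>2 \<le>
      ((x0 - xs) - (x' - xs)) \<bullet> (x' - xs) / \<eta>x - w \<bullet> K (x' - xs) + ys \<bullet> K (x' - xs)
      - (b - gradient f zs) \<bullet> (x' - xs)"
    if x': "x' = scaled_prox \<eta>x g (x0 - \<eta>x *\<^sub>R adjoint K w - \<eta>x *\<^sub>R b)" for x' x0 w b
  proof -
    have "(1 / \<eta>x) *\<^sub>R (x0 - \<eta>x *\<^sub>R adjoint K w - \<eta>x *\<^sub>R b - x') \<in> subdifferential g x'"
      unfolding x' by (rule scaled_prox_subgradient) fact+
    from subdifferential_strongly_monotone[OF \<open>proper_fun g\<close> \<open>strongly_convex_fun \<mu>g g\<close> this p]
    have "\<mu>g * (norm (x' - xs))\<^sup>2 \<le>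
      ((1 / \<eta>x) *\<^sub>R (x0 - x') - adjoint K w - b - p) \<bullet> (x' - xs)"
      using \<open>\<eta>x > 0\<close> by (simp add: scaleR_diff_right algebra_simps)
    then show ?thesis
      by (simp add: p_def inner_simps adjoint_clauses[OF linK] linear_diff[OF linK]
          diff_divide_distrib add_divide_distrib algebra_simps)
  qed
  have yopt: "\<mu>h * (norm (y' - ys))\<^sup>2 \<le>
      ((y0 - ys) - (y' - ys)) \<bullet> (y' - ys) / \<eta>y + (y' - ys) \<bullet> K (w - xs)"
    if y': "y' = scaled_prox \<eta>y ?h (y0 + \<eta>y *\<^sub>R K w)" for y' y0 w
  proof -
    have "(1 / \<eta>y) *\<^sub>R (y0 + \<eta>y *\<^sub>R K w - y') \<in> subdifferential ?h y'"
      unfolding y' by (rule scaled_prox_subgradient) fact+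
    from subdifferential_strongly_monotone[OF \<open>proper_fun ?h\<close> \<open>strongly_convex_fun \<mu>h ?h\<close> this q]
    have "\<mu>h * (norm (y' - ys))\<^sup>2 \<le> ((1 / \<eta>y) *\<^sub>R (y0 - y') + K (w - xs)) \<bullet> (y' - ys)"
      using \<open>\<eta>y > 0\<close> by (simp add: scaleR_diff_right linear_diff[OF linK] algebra_simps)
    then show ?thesis
      by (simp add: inner_add_left inner_commute[of "y' - ys" "K _"])
  qed
  \<comment> \<open>The averaging step is the implicit step
    \<open>z0 - z' = \<eta>z *\<^sub>R (z' - w)\<close>, here paired with an arbitrary vector;
    \<open>w\<close> is \<open>x k\<close> or its extrapolation.\<close>
  have zopt: "G' \<bullet> (z' - zs) = G' \<bullet> (z0 - z') / \<eta>z + G' \<bullet> (w - xs)"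
    if z': "z' = (1 / (1 + \<eta>z)) *\<^sub>R z0 + (\<eta>z / (1 + \<eta>z)) *\<^sub>R w" for z' z0 w G'
  proof -
    have "(1 + \<eta>z) *\<^sub>R z' = z0 + \<eta>z *\<^sub>R w"
      unfolding z' using \<open>\<eta>z > 0\<close> by (simp add: scaleR_add_right)
    then have "z0 - z' = \<eta>z *\<^sub>R (z' - w)"
      by (simp add: algebra_simps)
    then have "G' \<bullet> (z0 - z') / \<eta>z = G' \<bullet> (z' - w)"
      using \<open>\<eta>z > 0\<close> by simp
    then show ?thesis by (simp add: \<open>zs = xs\<close> inner_simps)
  qed
  \<comment> \<open>Reciprocals turn the maximum in \<open>\<theta>\<close> into a minimum, and
    \<open>2 / (2 + \<eta>z)\<close> is \<open>1 / (1 + \<eta>z / 2)\<close>.\<close>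
  define c where "c = min (\<mu>g * \<eta>x) (min (\<mu>h * \<eta>y) (\<eta>z / 2))"
  have c: "0 \<le> c" "c \<le> \<mu>g * \<eta>x" "c \<le> \<mu>h * \<eta>y" "c \<le> \<eta>z / 2"
    using assms by (auto simp: c_def)
  have \<theta>_eq: "\<theta> = 1 / (1 + c)"
  proof -
    have "2 / (2 + \<eta>z) = 1 / (1 + \<eta>z / 2)" using \<open>\<eta>z > 0\<close> by (simp add: field_simps)
    then have \<theta>: "\<theta> = max (1 / (1 + \<mu>g * \<eta>x)) (max (1 / (1 + \<mu>h * \<eta>y)) (1 / (1 + \<eta>z / 2)))"
      using assms(23) by simp
    have "max (1 / (1 + a)) (1 / (1 + b)) = 1 / (1 + min a b)" if "0 \<le> a" "0 \<le> b" for a b :: real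
      using that by (auto simp: max_def min_def field_simps)
    then show ?thesis unfolding \<theta> c_def using assms by simp
  qed
  have \<Psi>: "\<Psi> k = lyapunov f K \<eta>x \<eta>y \<eta>z s1 s2 zs (x k - xs) (y k - ys) (z k)" for k
    unfolding assms(22) lyapunov_def by simp
  have "(1 + c) * \<Psi> (Suc k) \<le> \<Psi> k" for k
    unfolding \<Psi>
  proof (rule lyapunov_decrease[OF assms(2,3) linK assms(1) \<open>\<eta>x > 0\<close> \<open>\<eta>y > 0\<close> \<open>\<eta>z > 0\<close> assms(20)
        _ _ refl refl _ c])
    show "\<bar>s1\<bar> = 1" "\<bar>s2\<bar> = 1" using assms(21) by auto
    note lin = linear_diff[OF linK] linear_cmul[OF linK] linear_add[OF linK]
    note expand = lin inner_diff_left inner_diff_right inner_add_left inner_add_right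
      inner_scaleR_left inner_scaleR_right
    let ?u = "x k - xs" and ?u' = "x (Suc k) - xs" and ?v = "y k - ys" and ?v' = "y (Suc k) - ys"
      and ?G = "gradient f (z k) - gradient f zs" and ?G' = "gradient f (z (Suc k)) - gradient f zs"
    \<comment> \<open>The extrapolated quantity decides the signs: \<open>s1\<close> is
      \<open>-1\<close> if the dual update extrapolates \<open>x\<close> and \<open>1\<close> if the
      primal update extrapolates \<open>y\<close>; \<open>s2\<close> is \<open>-1\<close> if the
      \<open>z\<close> update extrapolates \<open>x\<close> and \<open>1\<close> if the gradient is
      extrapolated.\<close>
    show "\<mu>g * (norm ?u')\<^sup>2 + \<mu>h * (norm ?v')\<^sup>2 + ?G' \<bullet> (z (Suc k) - zs) \<le>
       (?u - ?u') \<bullet> ?u' / \<eta>x + (?v - ?v') \<bullet> ?v' / \<eta>y + ?G' \<bullet> (z k - z (Suc k)) / \<eta>z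
       + s1 * (?v \<bullet> K ?u - ?v' \<bullet> K ?u' - (?v' - ?v) \<bullet> K (?u' - ?u))
       + s2 * (?G \<bullet> ?u - ?G' \<bullet> ?u' - (?G' - ?G) \<bullet> (?u' - ?u))" (is "?lhs \<le> ?N + _ + _")
      using assms(21)
    proof (elim disjE conjE)
      assume alg: "ACV_I f g h K \<eta>x \<eta>y \<eta>z x y z" and s: "s1 = -1" "s2 = -1"
      note upd = alg[unfolded ACV_I_def, THEN spec, of k]
      have "?lhs \<le> ?N - y k \<bullet> K ?u' + ys \<bullet> K ?u' + ?v' \<bullet> K (2 *\<^sub>R x (Suc k) - x k - xs)
          - (gradient f (z k) - gradient f zs) \<bullet> ?u' + ?G' \<bullet> (2 *\<^sub>R x (Suc k) - x k - xs)"
        using xopt[OF upd[THEN conjunct1]] yopt[OF upd[THEN conjunct2, THEN conjunct1]]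
          zopt[OF upd[THEN conjunct2, THEN conjunct2], of ?G'] by linarith
      then show ?thesis
        unfolding s by (simp add: expand algebra_simps)
    next
      assume alg: "ACV_II f g h K \<eta>x \<eta>y \<eta>z x y z" and s: "s1 = 1" "s2 = -1"
      note upd = alg[unfolded ACV_II_def, THEN spec, of k]
      have "?lhs \<le> ?N - (2 *\<^sub>R y (Suc k) - y k) \<bullet> K ?u' + ys \<bullet> K ?u' + ?v' \<bullet> K (x k - xs)
          - (gradient f (z k) - gradient f zs) \<bullet> ?u' + ?G' \<bullet> (2 *\<^sub>R x (Suc k) - x k - xs)"
        using xopt[OF upd[THEN conjunct2, THEN conjunct1]] yopt[OF upd[THEN conjunct1]]
          zopt[OF upd[THEN conjunct2, THEN conjunct2], of ?G'] by linarith
      then show ?thesis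
        unfolding s by (simp add: expand algebra_simps)
    next
      assume alg: "APDTR_I f g h K \<eta>x \<eta>y \<eta>z x y z" and s: "s1 = -1" "s2 = 1"
      note upd = alg[unfolded APDTR_I_def, THEN spec, of k]
      have "?lhs \<le> ?N - y k \<bullet> K ?u' + ys \<bullet> K ?u' + ?v' \<bullet> K (2 *\<^sub>R x (Suc k) - x k - xs)
          - (2 *\<^sub>R gradient f (z (Suc k)) - gradient f (z k) - gradient f zs) \<bullet> ?u' + ?G' \<bullet> (x k - xs)"
        using xopt[OF upd[THEN conjunct2, THEN conjunct1]] yopt[OF upd[THEN conjunct2, THEN conjunct2]]
          zopt[OF upd[THEN conjunct1], of ?G'] by linarith
      then show ?thesis
        unfolding s by (simp add: expand algebra_simps)
    next
      assume alg: "APDTR_II f g h K \<eta>x \<eta>y \<eta>z x y z" and s: "s1 = 1" "s2 = 1"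
      note upd = alg[unfolded APDTR_II_def, THEN spec, of k]
      have "?lhs \<le> ?N - (2 *\<^sub>R y (Suc k) - y k) \<bullet> K ?u' + ys \<bullet> K ?u' + ?v' \<bullet> K (x k - xs)
          - (2 *\<^sub>R gradient f (z (Suc k)) - gradient f (z k) - gradient f zs) \<bullet> ?u' + ?G' \<bullet> (x k - xs)"
        using xopt[OF upd[THEN conjunct2, THEN conjunct2]] yopt[OF upd[THEN conjunct1]]
          zopt[OF upd[THEN conjunct2, THEN conjunct1], of ?G'] by linarith
      then show ?thesis
        unfolding s by (simp add: expand algebra_simps)
    qed
  qed
  then have dec: "\<Psi> (Suc k) \<le> \<theta> * \<Psi> k" for k
    unfolding \<theta>_eq using c(1) by (simp add: field_simps)
  show ?thesis
  proof
    fix k show "\<Psi> k \<le> \<theta> ^ k * \<Psi> 0"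
    proof (induction k)
      case (Suc k)
      have "\<Psi> (Suc k) \<le> \<theta> * \<Psi> k" by (rule dec)
      also have "\<dots> \<le> \<theta> * (\<theta> ^ k * \<Psi> 0)"
        using Suc c(1) by (intro mult_left_mono) (auto simp: \<theta>_eq)
      finally show ?case by (simp add: mult.assoc)
    qed simp
  qed
qed

end
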